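(* The $0$-th rhythm polynomials, written in the variables $y_j$, satisfy the following recurrences. For every even $N=2m\geq 4$, $$Bav_{2m}^0=Bav_{2m-1}^0+y_{-m+2}\cdots y_{-1}\,y_1\cdots y_{m-1}\,(y_m+1)(y_0+y_{-m+1}).$$ For every odd $N=2m+1\geq 5$, $$Bav_{2m+1}^0=Bav_{2m}^0+y_{-m+1}\cdots y_{-1}\,y_1\cdots y_{m-1}\,(y_{-m}+1)(y_0+y_{m}).$$
   Context: Let $N\ge 3$ and $\mathbf{Z}_N=\{0,1,\dots,N-1\}$. For an integer $m$, $\langle m\rangle_N\in\mathbf{Z}_N$ is its least nonnegative remainder modulo $N$; $a+_Nb=\langle a+b\rangle_N$, $a-_Nb=\langle a-b\rangle_N$. For $a,b\in\mathbf{Z}_N$ put $av_{\mathbf{Z}_N}(a,b)=a+_N\left\lfloor\frac{b-_Na}{2}\right\rfloor$. Boolean average. For $\mathbf{v}=(v_0,\dots,v_{N-1})\in\mathbf{F}_2^N$ let $a_0<a_1<\dots<a_{n-1}$ be the elements of $\{i\in\mathbf{Z}_N: v_i=1\}$ in increasing order. $Bav(\mathbf{v})\in\mathbf{F}_2^N$ is the vector whose $i$-th coordinate is $1$ exactly when $i=av_{\mathbf{Z}_N}(a_k,a_{k+1})$ for some $0\le k\le n-1$, where $a_n:=a_0$ (so $Bav(\mathbf 0)=\mathbf 0$, and $Bav(\mathbf v)=\mathbf v$ if $n=1$). $Bav_N^0(\mathbf{v})\in\mathbf{F}_2$ denotes the $0$-th coordinate of $Bav(\mathbf{v})$; it is called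 the $0$-th rhythm polynomial modulo $N$. Index set. $\mathbf{Z}_{N,\pm}=\{-\lfloor\frac{N-1}{2}\rfloor,\dots,\lfloor\frac N2\rfloor\}$, and $\varphi_N:\mathbf{Z}_N\to\mathbf{Z}_{N,\pm}$ is the bijection with $\varphi_N(k)=k$ if $0\le k\le\lfloor\frac N2\rfloor$ and $\varphi_N(k)=k-N$ if $\lfloor\frac N2\rfloor<k\le N-1$. Variables. $Bav_N^0$ is regarded as a Boolean polynomial in the variables $y_j$, $j\in\mathbf{Z}_{N,\pm}$, through the substitution $v_i=y_{\varphi_N(i)}+1$ ($i\in\mathbf{Z}_N$), i.e. as an element of $\mathbf{F}_2[y_j: j\in\mathbf{Z}_{N,\pm}]/(y_j^2-y_j)$, equivalently an $\mathbf{F}_2$-valued function of the $y_j$. Since $\mathbf{Z}_{N-1,\pm}\subset\mathbf{Z}_{N,\pm}$, $Bav_{N-1}^0$ is also regarded as a polynomial in the variables $y_j$, $j\in\mathbf{Z}_{N,\pm}$ (not involving the extra variable). Products such as $y_{-m+2}\cdots y_{-1}$ run over consecutive indices and are $1$ when the index range is empty. *)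

theory Defs
  imports Complex_Main "HOL-Library.Z2"
begin

text \<open>
  The field with two elements is the type \<open>bit\<close>. A vector in \<open>F_2^N\<close> is a function
  \<open>int \<Rightarrow> bit\<close> of which only the coordinates in \<open>Z_N N\<close> are ever read; residues are integers
  throughout, so that the subtractions below are not truncated.
\<close>

definition Z_N :: "nat \<Rightarrow> int set" where
  "Z_N N = {0..<int N}"

definition add_N :: "nat \<Rightarrow> int \<Rightarrow> int \<Rightarrow> int" where
  "add_N N a b = (a + b) mod int N"

definition diff_N :: "nat \<Rightarrow> int \<Rightarrow> int \<Rightarrow> int" where
  "diff_N N a b = (a - b) mod int N"

definition av :: "nat \<Rightarrow> int \<Rightarrow> int \<Rightarrow> int" where
  "av N a b = add_N N a (diff_N N b a div 2)"

definition onsets :: "nat \<Rightarrow> (int \<Rightarrow> bit) \<Rightarrow> int list" where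
  "onsets N v = sorted_list_of_set {i \<in> Z_N N. v i = 1}"

text \<open>The convention \<open>a_n = a_0\<close> is expressed by reading the index \<open>k + 1\<close> modulo \<open>n\<close>.\<close>

definition Bav :: "nat \<Rightarrow> (int \<Rightarrow> bit) \<Rightarrow> int \<Rightarrow> bit" where
  "Bav N v i =
     (let a = onsets N v; n = length a
      in if \<exists>k<n. i = av N (a ! k) (a ! (Suc k mod n)) then 1 else 0)"

definition Z_pm :: "nat \<Rightarrow> int set" where
  "Z_pm N = {- ((int N - 1) div 2)..int N div 2}"

definition phi :: "nat \<Rightarrow> int \<Rightarrow> int" where
  "phi N k = (if k \<le> int N div 2 then k else k - int N)"

text \<open>
  Boolean polynomials in the variables \<open>y_j\<close>, taken modulo \<open>y_j^2 - y_j\<close>, are identified with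
  the \<open>bit\<close>-valued functions of the variables. An assignment \<open>y\<close> gives a value to every
  integer index, but the rhythm polynomial modulo \<open>N\<close> only involves those in \<open>Z_pm N\<close>
  (\<open>rhythm_poly_cong\<close>); so rhythm polynomials for different moduli are functions of the same
  assignment, which realises the inclusion of their sets of variables.
\<close>

definition rhythm_poly :: "nat \<Rightarrow> (int \<Rightarrow> bit) \<Rightarrow> bit" where
  "rhythm_poly N y = Bav N (\<lambda>i. y (phi N i) + 1) 0"

lemma bij_betw_phi: "bij_betw (phi N) (Z_N N) (Z_pm N)"
  by (rule bij_betw_byWitness[where f' = "\<lambda>j. if 0 \<le> j then j else j + int N"])
     (auto simp: phi_def Z_N_def Z_pm_def)

lemma Z_pm_mono: "M \<le> N \<Longrightarrow> Z_pm M \<subseteq> Z_pm N"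
  by (auto simp: Z_pm_def)

lemma rhythm_poly_cong:
  assumes "\<And>j. j \<in> Z_pm N \<Longrightarrow> y j = z j"
  shows "rhythm_poly N y = rhythm_poly N z"
proof -
  have "y (phi N i) = z (phi N i)" if "i \<in> Z_N N" for i
    using assms that bij_betw_phi bij_betwE by blast
  then have "{i \<in> Z_N N. y (phi N i) + 1 = 1} = {i \<in> Z_N N. z (phi N i) + 1 = 1}"
    by auto
  then show ?thesis
    unfolding rhythm_poly_def Bav_def onsets_def by simp
qed

end

theory Submission
  imports Defs
begin

text \<open>
  Write \<open>d\<close> for the cyclic distance from \<open>a\<close> to its cyclic successor \<open>b\<close> in the support. The
  average of \<open>a\<close> and \<open>b\<close> is \<open>0\<close> exactly when \<open>a\<close> and \<open>b\<close> are represented in \<open>Z_pm N\<close> by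
  \<open>- \<lfloor>d/2\<rfloor>\<close> and \<open>\<lceil>d/2\<rceil>\<close>. For \<open>1 \<le> d < N\<close> these events exclude each other and do not depend on
  \<open>N\<close>; the case \<open>d = 0\<close> is the event that the support is \<open>{0}\<close>. Passing from \<open>N\<close> to \<open>N + 1\<close>
  therefore adds the event \<open>d = N\<close> and removes the event that the support modulo \<open>N + 1\<close>
  consists of \<open>0\<close> and the new index.
\<close>

section \<open>Cyclic successors in a finite set of residues\<close>

text \<open>Neighbours in the increasing list satisfy the right side, and the right side determines
  \<open>b\<close> from \<open>a\<close>: two candidates would lie at the same cyclic distance from
  \<open>a\<close>. The converse follows by comparing \<open>b\<close> with the list neighbour of
  \<open>a\<close>. The clause on \<open>a = b\<close> is there because at distance \<open>0\<close>
  the betweenness condition is vacuous.\<close>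

lemma consecutive_iff:
  fixes A :: "int set"
  assumes A: "A \<subseteq> {0..<int N}"
  defines "xs \<equiv> sorted_list_of_set A"
  shows "(\<exists>k<length xs. a = xs ! k \<and> b = xs ! (Suc k mod length xs)) \<longleftrightarrow>
    a \<in> A \<and> b \<in> A \<and> (a = b \<longrightarrow> A = {a}) \<and>
    (\<forall>c\<in>A. \<not> (0 < (c - a) mod int N \<and> (c - a) mod int N < (b - a) mod int N))"
    (is "?L a b \<longleftrightarrow> ?R a b")
proof -
  have fin: "finite A"
    using A finite_subset by blast
  have set_xs: "set xs = A" and sorted: "sorted_wrt (<) xs" and dist: "distinct xs"
    using fin by (simp_all add: xs_def)
  have diff_mod: "(c - a) mod int N = (if a \<le> c then c - a else c - a + int N)"
    if "a \<in> A" "c \<in> A" for a c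
  proof -
    have "0 \<le> a" "a < int N" "0 \<le> c" "c < int N"
      using A that by auto
    then show ?thesis
      using mod_pos_pos_trivial[of "c - a" "int N"] mod_pos_pos_trivial[of "c - a + int N" "int N"]
      by auto
  qed
  have less_iff: "xs ! i < xs ! j \<longleftrightarrow> i < j" if "i < length xs" "j < length xs" for i j
    using sorted that by (metis sorted_wrt_nth_less not_less_iff_gr_or_eq)
  have succ: "?R a b" if "?L a b" for a b
  proof -
    from that obtain k where k: "k < length xs" "a = xs ! k" "b = xs ! (Suc k mod length xs)"
      by blast
    then have len: "Suc k mod length xs < length xs"
      using k(1) mod_less_divisor[of "length xs" "Suc k"] by linarith
    have ab: "a \<in> A" "b \<in> A"
      using k len set_xs nth_mem by metis+
    have "A = {a}" if "a = b"
    proof -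
      have "k = Suc k mod length xs"
        using that k len dist nth_eq_iff_index_eq by metis
      then have "length xs = 1" "k = 0"
        using k(1) by (cases "Suc k = length xs"; simp)+
      then show ?thesis
        using k(2) set_xs by (cases xs) auto
    qed
    moreover have "(b - a) mod int N \<le> (c - a) mod int N"
      if c: "c \<in> A" and pos: "0 < (c - a) mod int N" for c
    proof -
      obtain j where j: "j < length xs" "c = xs ! j"
        using c set_xs by (metis in_set_conv_nth)
      have "c < int N" "0 \<le> b" "b < int N" "0 \<le> a"
        using A ab c by auto
      have "a \<noteq> c"
        using pos by auto
      show ?thesis
      \<comment> \<open>At the last entry the index wraps around to \<open>0\<close>, so
        \<open>a\<close> is the maximum and \<open>b\<close> the minimum of
        \<open>A\<close>.\<close>
      proof (cases "Suc k = length xs")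
        case True
        then have "b \<le> c" "c \<le> a"
          using less_iff[OF j(1) len] less_iff[OF k(1) j(1)] j k by auto
        with \<open>a \<noteq> c\<close> show ?thesis
          using diff_mod[OF ab] diff_mod[OF ab(1) c] by auto
      next
        case False
        then have Suc: "Suc k < length xs" "Suc k mod length xs = Suc k"
          using k(1) by auto
        have "a < b"
          using less_iff[OF k(1) Suc(1)] k Suc by simp
        \<comment> \<open>If \<open>c < a\<close>, the distance from \<open>a\<close> to
          \<open>c\<close> wraps and is at least \<open>N - a\<close>, which exceeds
          \<open>b - a\<close>.\<close>
        moreover have "c < a \<or> b \<le> c"
          using less_iff[OF j(1) Suc(1)] less_iff[OF j(1) k(1)] j k Suc \<open>a \<noteq> c\<close>
          by (metis less_antisym not_less)
        ultimately show ?thesis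
          using diff_mod[OF ab] diff_mod[OF ab(1) c] \<open>0 \<le> b\<close> \<open>b < int N\<close> A c by auto
      qed
    qed
    ultimately show ?thesis
      using ab by (meson linorder_not_less)
  qed
  have unique: "b = b'" if "?R a b" "?R a b'" for a b b'
  proof (cases "a = b \<or> a = b'")
    case True
    with that show ?thesis
      by blast
  next
    case False
    have pos: "0 < (c - a) mod int N" if "c \<in> A" "a \<noteq> c" for c
    proof -
      have "a \<in> A" "a < int N" "0 \<le> c"
        using \<open>?R a b\<close> A that by auto
      then show ?thesis
        using diff_mod[of a c] that by auto
    qed
    have "(b - a) mod int N = (b' - a) mod int N"
      using that pos[of b] pos[of b'] False by (meson linorder_neqE)
    moreover have "b \<in> {0..<int N}" "b' \<in> {0..<int N}"
      using that A by auto
    ultimately show ?thesis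
      using diff_mod[of a b] diff_mod[of a b'] that by (auto split: if_splits)
  qed
  show ?thesis
  proof
    assume R: "?R a b"
    then obtain k where k: "k < length xs" "a = xs ! k"
      using set_xs by (metis in_set_conv_nth)
    then have "?L a (xs ! (Suc k mod length xs))"
      by blast
    then have "b = xs ! (Suc k mod length xs)"
      by (rule unique[OF R succ])
    with k show "?L a b"
      by blast
  qed (rule succ)
qed

section \<open>Gaps whose average is zero\<close>

text \<open>Since \<open>v = y + 1\<close>, a value \<open>0\<close> of \<open>y\<close> marks a
  member of the support. The right end is the ceiling of \<open>d/2\<close>. No modulus enters, so
  the same event serves all \<open>N\<close>.\<close>

definition centred_gap :: "(int \<Rightarrow> bit) \<Rightarrow> int \<Rightarrow> bool" where
  "centred_gap y d \<longleftrightarrow> y (- (d div 2)) = 0 \<and> y (d - d div 2) = 0 \<and>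
     (\<forall>j. - (d div 2) < j \<and> j < d - d div 2 \<longrightarrow> y j = 1)"

definition only_zero :: "nat \<Rightarrow> (int \<Rightarrow> bit) \<Rightarrow> bool" where
  "only_zero N y \<longleftrightarrow> y 0 = 0 \<and> (\<forall>j\<in>Z_pm N. j \<noteq> 0 \<longrightarrow> y j = 1)"

lemma phi_mod:
  assumes "j \<in> Z_pm N"
  shows "phi N (j mod int N) = j"
proof (cases "0 \<le> j")
  case True
  then show ?thesis
    using assms by (cases "j < int N") (auto simp: Z_pm_def phi_def)
next
  case False
  then have "j mod int N = (j + int N) mod int N" "0 \<le> j + int N" "j + int N < int N"
    using assms by (auto simp: Z_pm_def)
  then have "j mod int N = j + int N"
    by (metis mod_pos_pos_trivial)
  then show ?thesis
    using assms False by (auto simp: Z_pm_def phi_def)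
qed

text \<open>The bound on \<open>d\<close> is sharp: at \<open>d = N\<close> one end of the window is
  exactly the index that is new modulo \<open>N + 1\<close>.\<close>

lemma gap_in_Z_pm:
  assumes "0 \<le> d" "d < int N" "- (d div 2) \<le> j" "j \<le> d - d div 2"
  shows "j \<in> Z_pm N"
proof -
  have "d div 2 \<le> (int N - 1) div 2" "d - d div 2 \<le> int N div 2"
    using assms(1,2) by linarith+
  then show ?thesis
    using assms(3,4) by (simp add: Z_pm_def)
qed

lemma rhythm_poly_eq_1_iff:
  assumes "0 < N"
  shows "rhythm_poly N y = 1 \<longleftrightarrow>
    only_zero N y \<or> (\<exists>d. 1 \<le> d \<and> d < int N \<and> centred_gap y d)"
proof -
  define A where "A = {i \<in> Z_N N. y (phi N i) + 1 = 1}"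
  define R where "R a b \<longleftrightarrow> a \<in> A \<and> b \<in> A \<and> (a = b \<longrightarrow> A = {a}) \<and>
    (\<forall>c\<in>A. \<not> (0 < (c - a) mod int N \<and> (c - a) mod int N < (b - a) mod int N))" for a b
  have A: "A \<subseteq> {0..<int N}"
    by (auto simp: A_def Z_N_def)
  have mem: "j mod int N \<in> A \<longleftrightarrow> y j = 0" if "j \<in> Z_pm N" for j
    using assms that by (simp add: A_def Z_N_def phi_mod)
  have zero: "0 \<in> Z_pm N"
    using assms by (simp add: Z_pm_def)
  have "rhythm_poly N y = 1 \<longleftrightarrow> (\<exists>a b. R a b \<and> 0 = av N a b)"
    unfolding R_def consecutive_iff[OF A, symmetric]
    by (auto simp: rhythm_poly_def Bav_def onsets_def Let_def A_def)
  also have "\<dots> \<longleftrightarrow> only_zero N y \<or> (\<exists>d. 1 \<le> d \<and> d < int N \<and> centred_gap y d)"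
  proof
    assume "\<exists>a b. R a b \<and> 0 = av N a b"
    then obtain a b where R: "R a b" and av: "av N a b = 0"
      by auto
    define d where "d = (b - a) mod int N"
    have d: "0 \<le> d" "d < int N"
      using assms by (simp_all add: d_def)
    have ab: "a \<in> A" "b \<in> A" "0 \<le> a" "a < int N" "0 \<le> b" "b < int N"
      using R A by (auto simp: R_def)
    have "(a + d div 2) mod int N = 0"
      using av by (simp add: av_def add_N_def diff_N_def d_def)
    \<comment> \<open>Solving for \<open>a\<close> modulo \<open>N\<close>; adding \<open>d\<close>
      then yields \<open>b\<close>.\<close>
    then have "(a + d div 2 - d div 2) mod int N = (- (d div 2)) mod int N"
      by (metis diff_0 mod_diff_left_eq)
    then have a: "a = (- (d div 2)) mod int N"
      using ab by simp
    have "(a + d) mod int N = b"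
      using ab by (simp add: d_def mod_add_right_eq)
    then have b: "b = (d - d div 2) mod int N"
      unfolding a by (simp add: mod_add_left_eq)
    show "only_zero N y \<or> (\<exists>d. 1 \<le> d \<and> d < int N \<and> centred_gap y d)"
    proof (cases "a = b")
      case True
      then have "d = 0"
        by (simp add: d_def)
      then have "a = 0"
        using a by simp
      then have "A = {0}"
        using True R by (simp add: R_def)
      \<comment> \<open>Reduction modulo \<open>N\<close> is injective on \<open>Z_pm N\<close>,
        with \<open>phi N\<close> as left inverse.\<close>
      have "j mod int N \<noteq> 0" if "j \<in> Z_pm N" "j \<noteq> 0" for j
        using phi_mod[OF that(1)] phi_mod[OF zero] that(2) by auto
      then show ?thesis
        using mem mem[OF zero] \<open>A = {0}\<close> by (auto simp: only_zero_def)
    next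
      case False
      then have "d \<noteq> 0"
        using a b by auto
      have "y j = 1" if j: "- (d div 2) < j" "j < d - d div 2" for j
      proof -
        \<comment> \<open>An interior index of the window lies at a distance strictly between
          \<open>0\<close> and \<open>d\<close> from \<open>a\<close>, so betweenness keeps its
          residue out of \<open>A\<close>.\<close>
        have "(j mod int N - a) mod int N = (j + d div 2) mod int N"
          unfolding a by (simp add: mod_diff_eq)
        also have "\<dots> = j + d div 2"
          using j d by simp
        finally have "j mod int N \<notin> A"
          using R j unfolding R_def d_def[symmetric] by force
        then show ?thesis
          using mem[of j] gap_in_Z_pm[of d N j] j d by simp
      qed
      moreover have "y (- (d div 2)) = 0" "y (d - d div 2) = 0"
        using ab(1,2) mem[of "- (d div 2)"] mem[of "d - d div 2"] gap_in_Z_pm[of d N] d a b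
        by simp_all
      ultimately show ?thesis
        using d \<open>d \<noteq> 0\<close> unfolding centred_gap_def by (intro disjI2 exI[of _ d]) auto
    qed
  next
    assume "only_zero N y \<or> (\<exists>d. 1 \<le> d \<and> d < int N \<and> centred_gap y d)"
    then show "\<exists>a b. R a b \<and> 0 = av N a b"
    proof (elim disjE exE conjE)
      assume *: "only_zero N y"
      have "i = 0" if "i \<in> A" for i
      proof (rule ccontr)
        assume "i \<noteq> 0"
        have "i \<in> Z_N N" "y (phi N i) = 0"
          using that by (auto simp: A_def)
        moreover have "phi N i \<in> Z_pm N" "phi N i \<noteq> 0"
          using \<open>i \<in> Z_N N\<close> \<open>i \<noteq> 0\<close> bij_betwE[OF bij_betw_phi]
          by (auto simp: phi_def Z_N_def)
        ultimately show False
          using * by (auto simp: only_zero_def)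
      qed
      moreover have "0 \<in> A"
        using mem[OF zero] * by (simp add: only_zero_def)
      ultimately have "A = {0}"
        by blast
      then have "R 0 0"
        by (simp add: R_def)
      then show ?thesis
        by (intro exI[of _ 0]) (simp add: av_def add_N_def diff_N_def)
    next
      fix d assume d: "1 \<le> d" "d < int N" and gap: "centred_gap y d"
      \<comment> \<open>The witnesses are the residues of the two ends of the window.\<close>
      define a b where "a = (- (d div 2)) mod int N" and "b = (d - d div 2) mod int N"
      have ba: "(b - a) mod int N = d"
      proof -
        have "(b - a) mod int N = (d - d div 2 - - (d div 2)) mod int N"
          unfolding a_def b_def by (rule mod_diff_eq)
        then show ?thesis
          using d by simp
      qed
      have "a \<in> A" "b \<in> A"
        using gap mem[of "- (d div 2)"] mem[of "d - d div 2"] gap_in_Z_pm[of d N] d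
        by (simp_all add: a_def b_def centred_gap_def)
      moreover have "a \<noteq> b"
        using ba d by auto
      moreover have False
        if c: "c \<in> A" "0 < (c - a) mod int N" "(c - a) mod int N < d" for c
      proof -
        \<comment> \<open>The index \<open>e - d div 2\<close> represents \<open>c\<close> and is
          interior to the window, where \<open>y\<close> is \<open>1\<close>.\<close>
        define e where "e = (c - a) mod int N"
        have e: "0 < e" "e < d"
          using c by (simp_all add: e_def)
        have "(e - d div 2) mod int N = (e + a) mod int N"
          by (metis a_def add_uminus_conv_diff mod_add_right_eq)
        also have "\<dots> = c mod int N"
          by (simp add: e_def mod_add_left_eq)
        also have "\<dots> = c"
          using c(1) A by auto
        finally have "y (e - d div 2) = 0"
          using mem[of "e - d div 2"] gap_in_Z_pm[of d N "e - d div 2"] c(1) d e by simp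
        then show False
          using gap e by (auto simp: centred_gap_def)
      qed
      ultimately have "R a b"
        by (auto simp: R_def ba)
      moreover have "av N a b = 0"
        by (simp add: av_def add_N_def diff_N_def ba) (simp add: a_def mod_add_left_eq)
      ultimately show ?thesis
        by metis
    qed
  qed
  finally show ?thesis .
qed

section \<open>Exclusive events and the passage from \<open>N\<close> to
  \<open>N + 1\<close>\<close>

text \<open>The windows are nested, and enlarging \<open>d\<close> moves at least one end strictly
  outwards. The corresponding end of the smaller window is then interior to the larger one, so
  \<open>y\<close> would be both \<open>0\<close> and \<open>1\<close> there.\<close>

lemma centred_gap_unique:
  assumes "centred_gap y d" "centred_gap y d'" "1 \<le> d" "d < d'"
  shows False
proof (cases "d div 2 < d' div 2")
  case True
  then have "- (d' div 2) < - (d div 2)" "- (d div 2) < d' - d' div 2"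
    using assms by presburger+
  then have "y (- (d div 2)) = 1"
    using assms(2) unfolding centred_gap_def by blast
  then show False
    using assms(1) by (simp add: centred_gap_def)
next
  case False
  then have "- (d' div 2) < d - d div 2" "d - d div 2 < d' - d' div 2"
    using assms by presburger+
  then have "y (d - d div 2) = 1"
    using assms(2) unfolding centred_gap_def by blast
  then show False
    using assms(1) by (simp add: centred_gap_def)
qed

text \<open>The right end of the window is positive, and a support \<open>{0}\<close> leaves no room
  for it.\<close>

lemma only_zero_no_gap:
  assumes "only_zero N y" "1 \<le> d" "d < int N" "centred_gap y d"
  shows False
proof -
  have d: "d - d div 2 \<in> Z_pm N" "d - d div 2 \<noteq> 0"
    using assms(2,3) by (auto simp: Z_pm_def)
  then have "y (d - d div 2) = 1"
    using assms(1) by (simp add: only_zero_def)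
  then show False
    using assms(4) by (simp add: centred_gap_def)
qed

text \<open>Indicators of exclusive events add. The singleton event modulo \<open>N + 1\<close>
  implies the one modulo \<open>N\<close>, and over two elements the difference of the two
  indicators is also their sum.\<close>

lemma rhythm_poly_Suc:
  assumes "0 < N"
  shows "rhythm_poly (Suc N) y = rhythm_poly N y
    + (of_bool (only_zero N y \<and> \<not> only_zero (Suc N) y) + of_bool (centred_gap y (int N)))"
proof -
  define G where "G N \<longleftrightarrow> (\<exists>d. 1 \<le> d \<and> d < int N \<and> centred_gap y d)" for N
  have expand: "rhythm_poly M y = of_bool (only_zero M y) + of_bool (G M)" if "0 < M" for M
    using rhythm_poly_eq_1_iff[OF that, of y] only_zero_no_gap[of M y]
    by (cases "rhythm_poly M y") (auto simp: G_def)
  have "G (Suc N) \<longleftrightarrow> G N \<or> centred_gap y (int N)"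
    using assms proof -
    have "d < int (Suc N) \<longleftrightarrow> d < int N \<or> d = int N" for d
      by auto
    moreover have "1 \<le> int N"
      using assms by simp
    ultimately show ?thesis
      unfolding G_def by blast
  qed
  moreover have "\<not> (G N \<and> centred_gap y (int N))"
    using centred_gap_unique by (auto simp: G_def)
  moreover have "only_zero N y" if "only_zero (Suc N) y"
    using that Z_pm_mono[of N "Suc N"] by (auto simp: only_zero_def)
  ultimately show ?thesis
    using assms by (auto simp: expand)
qed

section \<open>The correction terms as products\<close>

lemma prod_bit_eq:
  fixes y :: "'a \<Rightarrow> bit"
  assumes "finite J"
  shows "(\<Prod>j\<in>J. y j) = of_bool (\<forall>j\<in>J. y j = 1)"
  using assms
proof induction
  case (insert x J)
  then show ?case
    by (cases "y x") simp_all
qed simp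

theorem theorem5p3:
  "(\<forall>(m::nat) (y :: int \<Rightarrow> bit). 2 * m \<ge> 4 \<longrightarrow>
      rhythm_poly (2 * m) y =
        rhythm_poly (2 * m - 1) y
        + (\<Prod>j = - int m + 2..-1. y j) * (\<Prod>j = 1..int m - 1. y j)
          * (y (int m) + 1) * (y 0 + y (- int m + 1)))
   \<and> (\<forall>(m::nat) (y :: int \<Rightarrow> bit). 2 * m + 1 \<ge> 5 \<longrightarrow>
      rhythm_poly (2 * m + 1) y =
        rhythm_poly (2 * m) y
        + (\<Prod>j = - int m + 1..-1. y j) * (\<Prod>j = 1..int m - 1. y j)
          * (y (- int m) + 1) * (y 0 + y (int m)))"
proof (intro conjI allI impI)
  fix m :: nat and y :: "int \<Rightarrow> bit"
  assume m: "4 \<le> 2 * m"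
  define L R where "L \<longleftrightarrow> (\<forall>j\<in>{- int m + 2..-1}. y j = 1)"
    and "R \<longleftrightarrow> (\<forall>j\<in>{1..int m - 1}. y j = 1)"
  have Suc: "Suc (2 * m - 1) = 2 * m" "0 < 2 * m - 1"
    using m by simp_all
  \<comment> \<open>The old indices are the two product ranges together with \<open>0\<close> and
    \<open>- m + 1\<close>; the new index is \<open>m\<close>.\<close>
  have Z: "Z_pm (2 * m - 1) = insert (- int m + 1) {- int m + 2..-1} \<union> insert 0 {1..int m - 1}"
    "Z_pm (2 * m) = insert (int m) (Z_pm (2 * m - 1))"
    using m by (auto simp: Z_pm_def)
  have zero: "only_zero (2 * m - 1) y \<longleftrightarrow> y 0 = 0 \<and> y (- int m + 1) = 1 \<and> L \<and> R"
    "only_zero (2 * m) y \<longleftrightarrow> only_zero (2 * m - 1) y \<and> y (int m) = 1"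
    using m unfolding only_zero_def Z L_def R_def by auto
  have ends: "int (2 * m - 1) div 2 = int m - 1" "int (2 * m - 1) - (int m - 1) = int m"
    using m by auto
  have "(\<forall>j. - (int m - 1) < j \<and> j < int m \<longrightarrow> y j = 1) \<longleftrightarrow>
    (\<forall>j\<in>{- int m + 2..-1} \<union> insert 0 {1..int m - 1}. y j = 1)"
  proof (intro iffI ballI allI impI)
    fix j
    assume *: "\<forall>j\<in>{- int m + 2..-1} \<union> insert 0 {1..int m - 1}. y j = 1" "- (int m - 1) < j \<and> j < int m"
    then have "j \<in> {- int m + 2..-1} \<union> insert 0 {1..int m - 1}"
      by auto
    with * show "y j = 1"
      by blast
  qed (use m in auto)
  then have gap: "centred_gap y (int (2 * m - 1)) \<longleftrightarrow>
    y (- int m + 1) = 0 \<and> y (int m) = 0 \<and> L \<and> y 0 = 1 \<and> R"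
    unfolding centred_gap_def ends L_def R_def by auto
  show "rhythm_poly (2 * m) y = rhythm_poly (2 * m - 1) y
      + (\<Prod>j = - int m + 2..-1. y j) * (\<Prod>j = 1..int m - 1. y j)
        * (y (int m) + 1) * (y 0 + y (- int m + 1))"
    \<comment> \<open>Both correction events require \<open>L\<close>, \<open>R\<close> and
      \<open>y m = 0\<close>. They differ in having \<open>y 0 = 0\<close>,
      \<open>y (- m + 1) = 1\<close> or the reverse, so together they say that
      \<open>y 0 + y (- m + 1) = 1\<close>.\<close>
    unfolding rhythm_poly_Suc[OF Suc(2), unfolded Suc(1)] zero gap
      prod_bit_eq[OF finite_atLeastAtMost_int] L_def[symmetric] R_def[symmetric]
    by (cases "y 0"; cases "y (int m)"; cases "y (- int m + 1)"; cases L; cases R) simp_all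
next
  fix m :: nat and y :: "int \<Rightarrow> bit"
  assume m: "5 \<le> 2 * m + 1"
  define L R where "L \<longleftrightarrow> (\<forall>j\<in>{- int m + 1..-1}. y j = 1)"
    and "R \<longleftrightarrow> (\<forall>j\<in>{1..int m - 1}. y j = 1)"
  have Suc: "Suc (2 * m) = 2 * m + 1" "0 < 2 * m"
    using m by simp_all
  have Z: "Z_pm (2 * m) = {- int m + 1..-1} \<union> insert 0 (insert (int m) {1..int m - 1})"
    "Z_pm (2 * m + 1) = insert (- int m) (Z_pm (2 * m))"
    using m by (auto simp: Z_pm_def)
  have zero: "only_zero (2 * m) y \<longleftrightarrow> y 0 = 0 \<and> y (int m) = 1 \<and> L \<and> R"
    "only_zero (2 * m + 1) y \<longleftrightarrow> only_zero (2 * m) y \<and> y (- int m) = 1"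
    using m unfolding only_zero_def Z L_def R_def by auto
  \<comment> \<open>For even distance \<open>2 * m\<close> the window is symmetric; its left end
    \<open>- m\<close> is the new index, and \<open>m\<close> takes over the part of
    \<open>- m + 1\<close>.\<close>
  have ends: "int (2 * m) div 2 = int m" "int (2 * m) - int m = int m"
    by auto
  have "(\<forall>j. - int m < j \<and> j < int m \<longrightarrow> y j = 1) \<longleftrightarrow>
    (\<forall>j\<in>{- int m + 1..-1} \<union> insert 0 {1..int m - 1}. y j = 1)"
  proof (intro iffI ballI allI impI)
    fix j
    assume *: "\<forall>j\<in>{- int m + 1..-1} \<union> insert 0 {1..int m - 1}. y j = 1" "- int m < j \<and> j < int m"
    then have "j \<in> {- int m + 1..-1} \<union> insert 0 {1..int m - 1}"
      by auto
    with * show "y j = 1"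
      by blast
  qed (use m in auto)
  then have gap: "centred_gap y (int (2 * m)) \<longleftrightarrow>
    y (- int m) = 0 \<and> y (int m) = 0 \<and> L \<and> y 0 = 1 \<and> R"
    unfolding centred_gap_def ends L_def R_def by auto
  show "rhythm_poly (2 * m + 1) y = rhythm_poly (2 * m) y
      + (\<Prod>j = - int m + 1..-1. y j) * (\<Prod>j = 1..int m - 1. y j)
        * (y (- int m) + 1) * (y 0 + y (int m))"
    unfolding rhythm_poly_Suc[OF Suc(2), unfolded Suc(1)] zero gap
      prod_bit_eq[OF finite_atLeastAtMost_int] L_def[symmetric] R_def[symmetric]
    by (cases "y 0"; cases "y (int m)"; cases "y (- int m)"; cases L; cases R) simp_all
qed

end
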